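(* Consider a positive and irreducible continuous-time Markov chain $(X_t)_{t\ge 0}$ characterised by $(\mathcal{X},\pi_0,Q)$ and a lumping map $\Lambda\colon\mathcal{X}\to\hat{\mathcal{X}}$. Let $f\in\mathcal{L}(\mathcal{X})$ be lumpable with respect to $\Lambda$ and let $\hat f$ be the corresponding element of $\mathcal{L}(\hat{\mathcal{X}})$, i.e. $f(x)=\hat f(\Lambda(x))$ for all $x\in\mathcal{X}$. Then for any $t\in\mathbb{R}_{\ge 0}$, \[ \hat\pi_0\,\underline{\hat T}_t\hat f\;\le\; E(f(X_t))=\pi_0T_tf\;\le\;-\hat\pi_0\,\underline{\hat T}_t(-\hat f), \] where $\hat\pi_0$ is the positive distribution on $\hat{\mathcal{X}}$ defined by $\hat\pi_0(\hat x):=\sum_{x\in\Gamma(\hat x)}\pi_0(x)$ for all $\hat x\in\hat{\mathcal{X}}$.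
   Context: $\mathcal{X}$ is a non-empty finite set; for a finite set $S$, $\mathcal{L}(S)$ is the set of real-valued functions on $S$ (column vectors), and distributions on $S$ are row vectors; a distribution is positive if all its components are $>0$. A transition rate matrix $Q$ on $\mathcal{X}$ is a real $|\mathcal{X}|\times|\mathcal{X}|$ matrix with non-negative off-diagonal entries and rows summing to zero; $T_t:=e^{tQ}$. $Q$ is irreducible if $T_t(x,y)>0$ for all $t>0$ and $x,y\in\mathcal{X}$. A homogeneous continuous-time Markov chain $(X_t)_{t\ge0}$ characterised by $(\mathcal{X},\pi_0,Q)$ has state space $\mathcal{X}$, initial distribution $\pi_0$ and transition probabilities $P(X_{t+\Delta}=y\mid X_t=x)=T_\Delta(x,y)$; it is called positive and irreducible if $\pi_0$ is positive and $Q$ is irreducible. A lumping map is a surjection $\Lambda\colon\mathcal{X}\to\hat{\mathcal{X}}$ with $1<|\hat{\mathcal{X}}|\le|\mathcal{X}|$; $\Gamma(\hat x):=\{x\in\mathcal{X}:\Lambda(x)=\hat x\}$. A function $f\in\mathcal{L}(\mathcal{X})$ is lumpable with respect to $\Lambda$ if there is $\hat f\in\mathcal{L}(\hat{\mathcal{X}})$ with $f(x)=\hat f(\Lambda(x))$ for all $x\in\mathcal{X}$. The (non-linear) lower transition rate operator $\underline{\hat Q}\colon\mathcal{L}(\hat{\mathcal{X}})\to\mathcal{L}(\hat{\mathcal{X}})$ is \[ [\underline{\hat Q}g](\hat x):=\min\Big\{\sum_{\hat y\in\hat{\mathcal{X}}}g(\hat y)\sum_{y\in\Gamma(\hat y)}Q(x,y):x\in\Gamma(\hat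 x)\Big\},\qquad \hat x\in\hat{\mathcal{X}}, \] and for $t\ge0$ the lower transition operator is $\underline{\hat T}_tg:=\lim_{n\to+\infty}\big(I+\tfrac tn\underline{\hat Q}\big)^ng$ (this limit exists), where $I$ is the identity and the $n$-th power means $n$ consecutive applications of the operator. *)

theory Defs
  imports "HOL-Probability.Probability"
begin

text \<open>
  The finite state spaces are finite types \<open>'x\<close> and \<open>'y\<close>. Functions on a state space and
  distributions on it are vectors of type \<open>real ^ 'x\<close>, and row \<open>x\<close>, column \<open>y\<close> of a matrix
  \<open>A\<close> is \<open>A $ x $ y\<close>. A column vector \<open>f\<close> is multiplied as \<open>A *v f\<close>, and a row vector \<open>p\<close>
  times a column vector \<open>f\<close> is the inner product \<open>p \<bullet> f\<close>.
\<close>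

subsection \<open>Distributions\<close>

definition distribution :: "real ^ 'x::finite \<Rightarrow> bool" where
  "distribution p \<longleftrightarrow> (\<forall>x. 0 \<le> p $ x) \<and> (\<Sum>x\<in>UNIV. p $ x) = 1"

definition positive_distribution :: "real ^ 'x::finite \<Rightarrow> bool" where
  "positive_distribution p \<longleftrightarrow> distribution p \<and> (\<forall>x. 0 < p $ x)"

subsection \<open>Transition rate matrices and transition matrices\<close>

definition transition_rate_matrix :: "real ^ 'x ^ 'x::finite \<Rightarrow> bool" where
  "transition_rate_matrix Q \<longleftrightarrow>
     (\<forall>x y. x \<noteq> y \<longrightarrow> 0 \<le> Q $ x $ y) \<and> (\<forall>x. (\<Sum>y\<in>UNIV. Q $ x $ y) = 0)"

text \<open>
  The type \<open>real ^ 'x ^ 'x\<close> carries the componentwise product, so the overloaded power and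
  \<open>exp\<close> cannot be used for the matrix power and the matrix exponential.
\<close>

primrec matrix_power :: "real ^ 'x ^ 'x::finite \<Rightarrow> nat \<Rightarrow> real ^ 'x ^ 'x" where
  "matrix_power A 0 = mat 1"
| "matrix_power A (Suc k) = A ** matrix_power A k"

definition matrix_exp :: "real ^ 'x ^ 'x::finite \<Rightarrow> real ^ 'x ^ 'x" where
  "matrix_exp A = (\<Sum>k. (1 / fact k) *\<^sub>R matrix_power A k)"

definition transition_matrix :: "real ^ 'x ^ 'x::finite \<Rightarrow> real \<Rightarrow> real ^ 'x ^ 'x" where
  "transition_matrix Q t = matrix_exp (t *\<^sub>R Q)"

definition irreducible_rate_matrix :: "real ^ 'x ^ 'x::finite \<Rightarrow> bool" where
  "irreducible_rate_matrix Q \<longleftrightarrow> (\<forall>t>0. \<forall>x y. 0 < transition_matrix Q t $ x $ y)"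

subsection \<open>Continuous-time Markov chains\<close>

text \<open>
  The process is indexed by \<open>real\<close>, but only times \<open>t \<ge> 0\<close> are constrained. Conditional
  probabilities are prescribed only when the conditioning event has positive probability.
  In the Markov property, \<open>S\<close> is an arbitrary finite set of past times and \<open>u\<close> gives the states
  visited at these times. No regularity of the sample paths is imposed.
\<close>

definition markov_chain ::
  "'w measure \<Rightarrow> (real \<Rightarrow> 'w \<Rightarrow> 'x::finite) \<Rightarrow> real ^ 'x \<Rightarrow> real ^ 'x ^ 'x \<Rightarrow> bool" where
  "markov_chain M X \<pi>\<^sub>0 Q \<longleftrightarrow>
     prob_space M \<and> distribution \<pi>\<^sub>0 \<and> transition_rate_matrix Q \<and>
     (\<forall>t\<ge>0. X t \<in> measurable M (count_space UNIV)) \<and>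
     (\<forall>x. \<P>(\<omega> in M. X 0 \<omega> = x) = \<pi>\<^sub>0 $ x) \<and>
     (\<forall>t\<ge>0. \<forall>\<Delta>\<ge>0. \<forall>S u x y. finite S \<longrightarrow> S \<subseteq> {0..<t} \<longrightarrow>
        0 < \<P>(\<omega> in M. X t \<omega> = x \<and> (\<forall>s\<in>S. X s \<omega> = u s)) \<longrightarrow>
        \<P>(\<omega> in M. X (t + \<Delta>) \<omega> = y \<bar> X t \<omega> = x \<and> (\<forall>s\<in>S. X s \<omega> = u s)) =
        \<P>(\<omega> in M. X (t + \<Delta>) \<omega> = y \<bar> X t \<omega> = x)) \<and>
     (\<forall>t\<ge>0. \<forall>\<Delta>\<ge>0. \<forall>x y. 0 < \<P>(\<omega> in M. X t \<omega> = x) \<longrightarrow>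
        \<P>(\<omega> in M. X (t + \<Delta>) \<omega> = y \<bar> X t \<omega> = x) = transition_matrix Q \<Delta> $ x $ y)"

definition positive_irreducible_markov_chain ::
  "'w measure \<Rightarrow> (real \<Rightarrow> 'w \<Rightarrow> 'x::finite) \<Rightarrow> real ^ 'x \<Rightarrow> real ^ 'x ^ 'x \<Rightarrow> bool" where
  "positive_irreducible_markov_chain M X \<pi>\<^sub>0 Q \<longleftrightarrow>
     markov_chain M X \<pi>\<^sub>0 Q \<and> positive_distribution \<pi>\<^sub>0 \<and> irreducible_rate_matrix Q"

subsection \<open>Lumping\<close>

definition lumping_map :: "('x::finite \<Rightarrow> 'y::finite) \<Rightarrow> bool" where
  "lumping_map \<Lambda> \<longleftrightarrow> surj \<Lambda> \<and> 1 < CARD('y) \<and> CARD('y) \<le> CARD('x)"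

definition lump :: "('x::finite \<Rightarrow> 'y::finite) \<Rightarrow> 'y \<Rightarrow> 'x set" where
  "lump \<Lambda> x' = {x. \<Lambda> x = x'}"

definition lumpable :: "('x::finite \<Rightarrow> 'y::finite) \<Rightarrow> real ^ 'x \<Rightarrow> bool" where
  "lumpable \<Lambda> f \<longleftrightarrow> (\<exists>f' :: real ^ 'y. \<forall>x. f $ x = f' $ \<Lambda> x)"

definition lumped_distribution ::
  "('x::finite \<Rightarrow> 'y::finite) \<Rightarrow> real ^ 'x \<Rightarrow> real ^ 'y" where
  "lumped_distribution \<Lambda> p = (\<chi> x'. \<Sum>x\<in>lump \<Lambda> x'. p $ x)"

definition lower_rate_operator ::
  "('x::finite \<Rightarrow> 'y::finite) \<Rightarrow> real ^ 'x ^ 'x \<Rightarrow> real ^ 'y \<Rightarrow> real ^ 'y" where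
  "lower_rate_operator \<Lambda> Q g =
     (\<chi> x'. Min ((\<lambda>x. \<Sum>y'\<in>UNIV. g $ y' * (\<Sum>y\<in>lump \<Lambda> y'. Q $ x $ y)) ` lump \<Lambda> x'))"

definition lower_transition_operator ::
  "('x::finite \<Rightarrow> 'y::finite) \<Rightarrow> real ^ 'x ^ 'x \<Rightarrow> real \<Rightarrow> real ^ 'y \<Rightarrow> real ^ 'y" where
  "lower_transition_operator \<Lambda> Q t g =
     lim (\<lambda>n. ((\<lambda>h. h + (t / real n) *\<^sub>R lower_rate_operator \<Lambda> Q h) ^^ n) g)"

end

theory Submission
  imports Defs
begin

text \<open>
  Once \<open>t / n\<close> is so small that \<open>I + (t / n) Q\<close> has non-negative entries, this matrix is monotone.
  Hence the Euler iterates of the lower rate operator, pulled back along \<open>\<Lambda>\<close>, stay below those of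
  \<open>Q\<close> started in the pulled back function. The latter converge to \<open>exp (t Q)\<close> by the binomial formula
  and Tannery's theorem. The former converge because the lower rate operator is Lipschitz:
  replacing each of \<open>n\<close> Euler steps by \<open>m\<close> smaller ones costs \<open>O(1 / n)\<close> uniformly in \<open>m\<close>, so the
  iterates form a Cauchy sequence. The upper bound is the lower bound for \<open>- f\<close>.
\<close>

subsection \<open>Convergence of the Euler scheme for Lipschitz maps\<close>

text \<open>An explicit Euler step for the equation h' = F h. Keeping \<open>F\<close> arbitrary
  covers both the non-linear lower rate operator and the linear map of \<open>Q\<close>.\<close>

definition euler_step :: "('a \<Rightarrow> 'a) \<Rightarrow> real \<Rightarrow> 'a \<Rightarrow> 'a::real_vector" where
  "euler_step F d h = h + d *\<^sub>R F h"

lemma one_plus_power_le_exp: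
  fixes a :: real
  assumes "0 \<le> a"
  shows "(1 + a) ^ n \<le> exp (real n * a)"
proof -
  have "(1 + a) ^ n \<le> exp a ^ n"
    using assms by (intro power_mono) auto
  then show ?thesis
    by (simp add: exp_of_nat_mult)
qed

context
  fixes F :: "'a::banach \<Rightarrow> 'a" and L :: real
  assumes lip: "L-lipschitz_on UNIV F"
begin

lemma lipschitz_norm_diff_le: "norm (F g - F h) \<le> L * norm (g - h)"
  using lip by (auto simp: lipschitz_on_def dist_norm)

lemma lipschitz_const_nonneg: "0 \<le> L"
  using lip by (rule lipschitz_on_nonneg)

lemma norm_euler_step_diff_le:
  assumes "0 \<le> d"
  shows "norm (euler_step F d g - euler_step F d h) \<le> (1 + L * d) * norm (g - h)"
proof -
  have "norm (euler_step F d g - euler_step F d h) = norm ((g - h) + d *\<^sub>R (F g - F h))"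
    by (simp add: euler_step_def algebra_simps)
  also have "\<dots> \<le> norm (g - h) + d * norm (F g - F h)"
    using assms norm_triangle_ineq[of "g - h" "d *\<^sub>R (F g - F h)"] by simp
  also have "\<dots> \<le> norm (g - h) + d * (L * norm (g - h))"
    using assms by (intro add_left_mono mult_left_mono lipschitz_norm_diff_le)
  finally show ?thesis
    by (simp add: algebra_simps)
qed

text \<open>A step moves the argument by \<open>d *\<^sub>R F k\<close>, so by the Lipschitz bound
  each step enlarges the norm of \<open>F\<close> by a factor of at most
  \<open>1 + L * d\<close>.\<close>

lemma norm_euler_iterate_le:
  assumes "0 \<le> d"
  shows "norm (F ((euler_step F d ^^ n) h)) \<le> exp (real n * (L * d)) * norm (F h)"
proof -
  have "norm (F ((euler_step F d ^^ n) h)) \<le> (1 + L * d) ^ n * norm (F h)"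
  proof (induction n)
    case 0
    then show ?case by simp
  next
    case (Suc n)
    define k where "k = (euler_step F d ^^ n) h"
    have "norm (F (euler_step F d k)) \<le> norm (F k) + norm (F (euler_step F d k) - F k)"
      by (metis add.commute diff_add_cancel norm_triangle_ineq)
    also have "\<dots> \<le> norm (F k) + L * norm (euler_step F d k - k)"
      by (intro add_left_mono lipschitz_norm_diff_le)
    also have "\<dots> = (1 + L * d) * norm (F k)"
      using assms by (simp add: euler_step_def algebra_simps)
    also have "\<dots> \<le> (1 + L * d) * ((1 + L * d) ^ n * norm (F h))"
      using Suc assms lipschitz_const_nonneg unfolding k_def by (intro mult_left_mono) auto
    finally show ?case
      by (simp add: k_def mult.assoc)
  qed
  also have "\<dots> \<le> exp (real n * (L * d)) * norm (F h)"
    using assms lipschitz_const_nonneg by (intro mult_right_mono one_plus_power_le_exp) auto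
  finally show ?thesis .
qed

text \<open>During the small steps \<open>F\<close> is evaluated close to \<open>h\<close>, so
  replacing it by \<open>F h\<close> makes an error of second order in the total length
  \<open>real m * d\<close>. The bound depends on \<open>m\<close> through this length
  alone.\<close>

lemma euler_iterate_local_error:
  assumes "0 \<le> d"
  shows "norm ((euler_step F d ^^ m) h - euler_step F (real m * d) h)
           \<le> L * (real m * d)\<^sup>2 * (exp (real m * (L * d)) * norm (F h))"
proof -
  define K where "K = exp (real m * (L * d)) * norm (F h)"
  have K0: "0 \<le> K" by (simp add: K_def)
  define b where "b j = (euler_step F d ^^ j) h" for j
  have b_Suc: "b (Suc j) = b j + d *\<^sub>R F (b j)" for j
    by (simp add: b_def euler_step_def)
  \<comment> \<open>\<open>K\<close> bounds the speed along the whole path; hence \<open>A\<close>,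
    the distance travelled after \<open>j\<close> small steps.\<close>
  have FK: "norm (F (b j)) \<le> K" if "j \<le> m" for j
  proof -
    have "norm (F (b j)) \<le> exp (real j * (L * d)) * norm (F h)"
      unfolding b_def using assms by (rule norm_euler_iterate_le)
    also have "\<dots> \<le> K"
      unfolding K_def using that assms lipschitz_const_nonneg by (intro mult_right_mono) (auto intro!: mult_right_mono)
    finally show ?thesis .
  qed
  have A: "norm (b j - h) \<le> real j * d * K" if "j \<le> m" for j
    using that
  proof (induction j)
    case 0
    then show ?case by (simp add: b_def)
  next
    case (Suc j)
    have "norm (b (Suc j) - h) \<le> norm (b j - h) + norm (d *\<^sub>R F (b j))"
      using norm_triangle_ineq[of "b j - h" "d *\<^sub>R F (b j)"] by (simp add: b_Suc algebra_simps)
    also have "\<dots> \<le> real j * d * K + d * K"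
      using Suc FK[of j] assms by (auto intro!: add_mono mult_left_mono)
    finally show ?case by (simp add: algebra_simps)
  qed
  \<comment> \<open>The comparison is with one step of length \<open>real j * d\<close>, so the
    target grows along with \<open>j\<close> and induction applies.\<close>
  have B: "norm (b j - euler_step F (real j * d) h) \<le> L * (real j * d)\<^sup>2 * K" if "j \<le> m" for j
    using that
  proof (induction j)
    case 0
    then show ?case by (simp add: b_def euler_step_def)
  next
    case (Suc j)
    have "norm (b (Suc j) - euler_step F (real (Suc j) * d) h)
        = norm ((b j - euler_step F (real j * d) h) + d *\<^sub>R (F (b j) - F h))"
      by (simp add: b_Suc euler_step_def algebra_simps)
    also have "\<dots> \<le> norm (b j - euler_step F (real j * d) h) + d * norm (F (b j) - F h)"
      using norm_triangle_ineq[of "b j - euler_step F (real j * d) h" "d *\<^sub>R (F (b j) - F h)"] assms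
      by simp
    also have "\<dots> \<le> L * (real j * d)\<^sup>2 * K + d * (L * (real j * d * K))"
    proof (intro add_mono mult_left_mono)
      show "norm (F (b j) - F h) \<le> L * (real j * d * K)"
        using lipschitz_norm_diff_le[of "b j" h] A[of j] Suc.prems lipschitz_const_nonneg
        by (meson Suc_leD mult_left_mono order_trans)
    qed (use Suc assms in auto)
    also have "\<dots> = (L * d\<^sup>2 * K) * ((real j)\<^sup>2 + real j)"
      by (simp add: power2_eq_square algebra_simps)
    \<comment> \<open>The new error is linear in j, and j^2 + j is at most (j + 1)^2.\<close>
    also have "\<dots> \<le> (L * d\<^sup>2 * K) * (real (Suc j))\<^sup>2"
      using lipschitz_const_nonneg K0 by (intro mult_left_mono) (auto simp: power2_eq_square algebra_simps)
    also have "\<dots> = L * (real (Suc j) * d)\<^sup>2 * K"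
      by (simp add: power2_eq_square algebra_simps)
    finally show ?case .
  qed
  show ?thesis
    using B[of m] by (simp add: b_def K_def)
qed

text \<open>Each coarse step amplifies the error made so far by at most \<open>exp (L * D)\<close>
  and adds one local error. For \<open>D = t / n\<close> the sum of n terms of order D^2 is of order
  1 / n, whatever \<open>m\<close> is.\<close>

lemma euler_refinement_error:
  fixes m :: nat
  assumes "0 \<le> d"
  defines "D \<equiv> real m * d"
  shows "norm ((euler_step F D ^^ n) g - (euler_step F d ^^ (n * m)) g)
           \<le> real n * (L * D\<^sup>2) * (exp (real n * (L * D)) * norm (F g))"
proof (induction n)
  case 0
  then show ?case by simp
next
  case (Suc n)
  have D0: "0 \<le> D" using assms by simp
  define a where "a = (euler_step F D ^^ n) g"
  define b where "b = (euler_step F d ^^ (n * m)) g"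
  define e where "e = exp (real (Suc n) * (L * D)) * norm (F g)"
  have e: "exp (L * D) * (exp (real n * (L * D)) * norm (F g)) = e"
    by (simp add: e_def algebra_simps exp_add)
  \<comment> \<open>Inserting the coarse step from the fine iterate \<open>b\<close> separates the
    propagated error from the local error at \<open>b\<close>.\<close>
  have "norm (euler_step F D a - (euler_step F d ^^ m) b)
      \<le> norm (euler_step F D a - euler_step F D b)
        + norm (euler_step F D b - (euler_step F d ^^ m) b)"
    using norm_triangle_ineq[of "euler_step F D a - euler_step F D b"
        "euler_step F D b - (euler_step F d ^^ m) b"] by simp
  also have "\<dots> \<le> exp (L * D) * (real n * (L * D\<^sup>2) * (exp (real n * (L * D)) * norm (F g)))
      + L * D\<^sup>2 * (exp (L * D) * (exp (real n * (L * D)) * norm (F g)))"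
  proof (intro add_mono)
    have "norm (euler_step F D a - euler_step F D b) \<le> (1 + L * D) * norm (a - b)"
      using D0 by (rule norm_euler_step_diff_le)
    also have "\<dots> \<le> exp (L * D) * norm (a - b)"
      by (intro mult_right_mono) auto
    also have "\<dots> \<le> exp (L * D) * (real n * (L * D\<^sup>2) * (exp (real n * (L * D)) * norm (F g)))"
      using Suc unfolding a_def b_def by (intro mult_left_mono) auto
    finally show "norm (euler_step F D a - euler_step F D b) \<le> \<dots>" .
    have "norm (euler_step F D b - (euler_step F d ^^ m) b)
        \<le> L * D\<^sup>2 * (exp (L * D) * norm (F b))"
      using euler_iterate_local_error[OF assms(1), of m b]
      by (simp add: D_def norm_minus_commute mult_ac)
    also have "norm (F b) \<le> exp (real n * (L * D)) * norm (F g)"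
      using norm_euler_iterate_le[OF assms(1), of "n * m" g] by (simp add: b_def D_def mult_ac)
    finally show "norm (euler_step F D b - (euler_step F d ^^ m) b)
        \<le> L * D\<^sup>2 * (exp (L * D) * (exp (real n * (L * D)) * norm (F g)))"
      using lipschitz_const_nonneg by (simp add: mult_left_mono)
  qed
  also have "\<dots> = real (Suc n) * (L * D\<^sup>2) * e"
    unfolding e[symmetric] by (simp add: algebra_simps)
  finally show ?case
    by (simp add: a_def b_def e_def funpow_add)
qed

text \<open>The iterates for m and n are both compared with the one for m * n, a common refinement
  of the two partitions.\<close>

lemma euler_convergent:
  assumes "0 \<le> t"
  shows "convergent (\<lambda>n. (euler_step F (t / real n) ^^ n) g)"
proof -
  define a where "a n = (euler_step F (t / real n) ^^ n) g" for n
  define C where "C = L * t\<^sup>2 * (exp (L * t) * norm (F g))"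
  have C0: "0 \<le> C" using lipschitz_const_nonneg by (simp add: C_def)
  have refine: "norm (a n - a (n * m)) \<le> C / real n" if "0 < n" "0 < m" for n m
  proof -
    have "real m * (t / real (n * m)) = t / real n" "real n * (t / real n) = t"
      using that by auto
    then show ?thesis
      using euler_refinement_error[where d = "t / real (n * m)" and m = m and n = n and g = g] assms that
      by (simp add: a_def C_def power2_eq_square field_simps)
  qed
  have "Cauchy a"
  proof (rule CauchyI')
    fix e :: real assume e: "0 < e"
    \<comment> \<open>From \<open>N\<close> on each of the two refinement errors is below e /
      2.\<close>
    obtain N :: nat where N: "2 * C / e < real N"
      using reals_Archimedean2 by blast
    have "0 < N" using N C0 e by (metis divide_nonneg_pos mult_nonneg_nonneg of_nat_0_less_iff
          order_le_less_trans zero_le_numeral)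
    have "norm (a m - a n) < e" if "N \<le> m" "m < n" for m n
    proof -
      have "0 < m" "0 < n" using that \<open>0 < N\<close> by auto
      have small: "C / real k < e / 2" if "N \<le> k" for k
      proof -
        have "2 * C / e < real k" using N that by linarith
        then show ?thesis using e \<open>0 < N\<close> that by (simp add: field_simps)
      qed
      have "norm (a m - a n) \<le> norm (a m - a (m * n)) + norm (a n - a (n * m))"
        using norm_triangle_ineq4[of "a m - a (m * n)" "a n - a (n * m)"] by (simp add: mult.commute)
      also have "\<dots> \<le> C / real m + C / real n"
        using refine \<open>0 < m\<close> \<open>0 < n\<close> by (intro add_mono) auto
      also have "\<dots> < e" using small[of m] small[of n] that by linarith
      finally show ?thesis .
    qed
    then show "\<exists>N. \<forall>m\<ge>N. \<forall>n>m. dist (a m) (a n) < e"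
      unfolding dist_norm by blast
  qed
  then show ?thesis
    by (simp add: Cauchy_convergent_iff a_def[abs_def])
qed

end

subsection \<open>The matrix exponential as a limit of powers\<close>

text \<open>Supplies a constant for bounding norms of products, and the distribution of
  \<open>**\<close> over sums.\<close>

lemma bounded_bilinear_matrix_matrix_mult:
  "bounded_bilinear ((**) :: real^'m^'n \<Rightarrow> real^'p^'m \<Rightarrow> real^'p^'n)"
  unfolding bilinear_conv_bounded_bilinear[symmetric] bilinear_def
  by (auto intro!: linearI simp: matrix_add_ldistrib matrix_scalar_ac scalar_matrix_assoc
      matrix_matrix_mult_def vec_eq_iff sum.distrib distrib_left distrib_right sum_distrib_left mult_ac)

text \<open>The constant of the bilinear bound is absorbed into \<open>c\<close>. The geometric
  growth makes the exponential series a majorant.\<close>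

lemma norm_matrix_power_le:
  fixes A :: "real^'x^'x::finite"
  obtains c where "\<And>k. norm (matrix_power A k) \<le> c ^ k * norm (mat 1 :: real^'x^'x)"
proof -
  obtain K where K: "0 \<le> K" "norm (B ** C) \<le> norm B * norm C * K" for B C :: "real^'x^'x"
    using bounded_bilinear.nonneg_bounded[OF bounded_bilinear_matrix_matrix_mult] by blast
  have "norm (matrix_power A k) \<le> (norm A * K) ^ k * norm (mat 1 :: real^'x^'x)" for k
  proof (induction k)
    case 0
    then show ?case by simp
  next
    case (Suc k)
    have "norm (A ** matrix_power A k) \<le> (norm A * K) * norm (matrix_power A k)"
      using K(2)[of A "matrix_power A k"] by (simp add: mult_ac)
    also have "\<dots> \<le> (norm A * K) * ((norm A * K) ^ k * norm (mat 1 :: real^'x^'x))"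
      using Suc K(1) by (intro mult_left_mono) auto
    finally show ?case by (simp add: mult_ac)
  qed
  then show ?thesis by (rule that)
qed

lemma summable_exp_bound: "summable (\<lambda>k. (1 / fact k) * (c ^ k * b :: real))"
  using summable_mult2[OF summable_exp[of c], of b] by (simp add: field_simps)

lemma summable_matrix_exp:
  "summable (\<lambda>k. (1 / fact k) *\<^sub>R matrix_power (A :: real^'x^'x::finite) k)"
proof -
  obtain c where c: "\<And>k. norm (matrix_power A k) \<le> c ^ k * norm (mat 1 :: real^'x^'x)"
    using norm_matrix_power_le[of A] by metis
  show ?thesis
    by (rule summable_comparison_test'[OF summable_exp_bound[of c "norm (mat 1 :: real^'x^'x)"]])
      (use c in \<open>auto intro!: divide_right_mono\<close>)
qed

lemma matrix_power_scaleR: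
  "matrix_power (c *\<^sub>R A) k = c ^ k *\<^sub>R matrix_power (A :: real^'x^'x::finite) k"
proof (induction k)
  case (Suc k)
  then show ?case
    by (simp add: matrix_scalar_ac scalar_matrix_assoc[symmetric] mult_ac)
qed simp

lemma matrix_power_one_plus:
  fixes A :: "real^'x^'x::finite"
  shows "matrix_power (mat 1 + A) n = (\<Sum>k\<le>n. real (n choose k) *\<^sub>R matrix_power A k)"
proof (induction n)
  case (Suc n)
  let ?P = "matrix_power A"
  have A: "A ** (\<Sum>k\<le>n. real (n choose k) *\<^sub>R ?P k) = (\<Sum>k\<le>n. real (n choose k) *\<^sub>R ?P (Suc k))"
    by (simp add: bounded_bilinear.sum_right[OF bounded_bilinear_matrix_matrix_mult]
        matrix_scalar_ac scalar_matrix_assoc)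
  \<comment> \<open>Splitting off k = 0 lets Pascal's rule apply to every remaining
    coefficient.\<close>
  have "(\<Sum>k\<le>Suc n. real (Suc n choose k) *\<^sub>R ?P k)
      = ?P 0 + (\<Sum>k\<le>n. real (Suc n choose Suc k) *\<^sub>R ?P (Suc k))"
    by (subst sum.atMost_Suc_shift) simp
  also have "\<dots> = (?P 0 + (\<Sum>k\<le>n. real (n choose Suc k) *\<^sub>R ?P (Suc k)))
      + (\<Sum>k\<le>n. real (n choose k) *\<^sub>R ?P (Suc k))"
    by (simp add: scaleR_add_left sum.distrib del: matrix_power.simps)
  also have "?P 0 + (\<Sum>k\<le>n. real (n choose Suc k) *\<^sub>R ?P (Suc k))
      = (\<Sum>k\<le>Suc n. real (n choose k) *\<^sub>R ?P k)"
    using sum.atMost_Suc_shift[of "\<lambda>k. real (n choose k) *\<^sub>R ?P k" n]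
    by (simp del: matrix_power.simps)
  \<comment> \<open>The top term vanishes because \<open>n choose Suc n\<close> is 0.\<close>
  also have "\<dots> = (\<Sum>k\<le>n. real (n choose k) *\<^sub>R ?P k)"
    by (simp del: matrix_power.simps)
  finally show ?case
    by (simp add: Suc A bounded_bilinear.add_left[OF bounded_bilinear_matrix_matrix_mult]
        del: matrix_power.simps(1) sum.atMost_Suc)
qed simp

text \<open>Passing from k to k + 1 multiplies the term by (1 - k / n) / (k + 1), which tends to 1 /
  (k + 1).\<close>

lemma binomial_div_power_tendsto:
  "(\<lambda>n. real (n choose k) * (1 / real n) ^ k) \<longlonglongrightarrow> 1 / fact k"
proof (induction k)
  case 0
  then show ?case by simp
next
  case (Suc k)
  have "(\<lambda>n. (1 - real k / real n) / real (Suc k)) \<longlonglongrightarrow> (1 - 0) / real (Suc k)"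
    by (intro tendsto_intros lim_const_over_n) auto
  from tendsto_mult[OF Suc this]
  have "(\<lambda>n. real (n choose k) * (1 / real n) ^ k * ((1 - real k / real n) / real (Suc k)))
      \<longlonglongrightarrow> 1 / fact (Suc k)"
    by (simp add: field_simps)
  moreover have "\<forall>\<^sub>F n in sequentially.
      real (n choose k) * (1 / real n) ^ k * ((1 - real k / real n) / real (Suc k))
        = real (n choose Suc k) * (1 / real n) ^ Suc k"
    using eventually_ge_at_top[of "Suc k"]
  proof eventually_elim
    case (elim n)
    have "Suc k * (n choose Suc k) = (n - k) * (n choose k)"
      by (metis binomial_absorb_comp binomial_absorption binomial_symmetric mult.commute
        binomial_fact_lemma Suc_leD)
    then have "real (Suc k) * real (n choose Suc k) = (real n - real k) * real (n choose k)"
      using elim by (metis Suc_leD of_nat_diff of_nat_mult)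
    then have choose: "real (n choose Suc k) = (real n - real k) * real (n choose k) / real (Suc k)"
      by (simp add: field_simps)
    have "1 - real k / real n = (real n - real k) * (1 / real n)"
      using elim by (simp add: field_simps)
    then show ?case
      by (simp only: choose power_Suc divide_inverse mult_ac)
  qed
  ultimately show ?case
    by (rule Lim_transform_eventually)
qed

text \<open>Entry by entry, the coefficient \<open>w k n\<close> of the k-th power tends to
  \<open>1 / fact k\<close> and never exceeds it, so the exponential series dominates uniformly in
  n.\<close>

lemma matrix_power_tendsto_matrix_exp:
  fixes A :: "real^'x^'x::finite"
  shows "(\<lambda>n. matrix_power (mat 1 + (1 / real n) *\<^sub>R A) n) \<longlonglongrightarrow> matrix_exp A"
proof (intro vec_tendstoI)
  fix i j
  obtain c where c: "\<And>k. norm (matrix_power A k) \<le> c ^ k * norm (mat 1 :: real^'x^'x)"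
    using norm_matrix_power_le[of A] by metis
  define b where "b = norm (mat 1 :: real^'x^'x)"
  define w where "w k n = real (n choose k) * (1 / real n) ^ k" for k n
  have entry: "\<bar>matrix_power A k $ i $ j\<bar> \<le> c ^ k * b" for k
    using c[of k] component_le_norm_cart[of "matrix_power A k $ i" j]
      Finite_Cartesian_Product.norm_nth_le[of "matrix_power A k" i]
    unfolding b_def by linarith
  have w_le: "w k n \<le> 1 / fact k" for k n
  proof (cases "n = 0")
    case False
    have "real ((n choose k) * fact k) \<le> real (n ^ k)"
      using binomial_fact_pow[of n k] by (rule of_nat_mono)
    with False show ?thesis by (simp add: w_def field_simps)
  \<comment> \<open>For n = 0 the quotient \<open>1 / real n\<close> is 0, so \<open>w k 0\<close>
    is 1 for k = 0 and 0 otherwise.\<close>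
  qed (cases k; auto simp: w_def)
  have bound: "norm (w k n * (matrix_power A k $ i $ j)) \<le> (1 / fact k) * (c ^ k * b)" for k n
    unfolding norm_mult using entry[of k] w_le[of k n]
    by (intro mult_mono) (auto simp: w_def)
  have "(\<lambda>n. suminf (\<lambda>k. w k n * (matrix_power A k $ i $ j)))
      \<longlonglongrightarrow> (\<Sum>k. (1 / fact k) * (matrix_power A k $ i $ j))"
  proof (intro conjunct2[OF conjunct2[OF tannerys_theorem]])
    show "(\<lambda>n. w k n * (matrix_power A k $ i $ j))
        \<longlonglongrightarrow> (1 / fact k) * (matrix_power A k $ i $ j)" for k
      unfolding w_def by (intro tendsto_mult binomial_div_power_tendsto tendsto_const)
    show "\<forall>\<^sub>F (k, n) in at_top \<times>\<^sub>F sequentially.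
        norm (w k n * (matrix_power A k $ i $ j)) \<le> (1 / fact k) * (c ^ k * b)"
      using bound by (intro always_eventually) auto
  qed (use summable_exp_bound[of c b] in auto)
  moreover have "(\<Sum>k. w k n * (matrix_power A k $ i $ j))
      = matrix_power (mat 1 + (1 / real n) *\<^sub>R A) n $ i $ j" for n
  proof -
    \<comment> \<open>The coefficients vanish for k > n, so the binomial sum is an infinite series
      as Tannery's theorem requires.\<close>
    have "(\<Sum>k. w k n * (matrix_power A k $ i $ j)) = (\<Sum>k\<le>n. w k n * (matrix_power A k $ i $ j))"
      by (rule suminf_finite) (auto simp: w_def)
    then show ?thesis
      by (simp add: matrix_power_one_plus matrix_power_scaleR w_def)
  qed
  moreover have "(\<Sum>k. (1 / fact k) * (matrix_power A k $ i $ j)) = matrix_exp A $ i $ j"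
  proof -
    have "bounded_linear (\<lambda>B :: real^'x^'x. B $ i $ j)"
      by (intro bounded_linear_compose[OF bounded_linear_vec_nth bounded_linear_vec_nth])
    from bounded_linear.suminf[OF this summable_matrix_exp[of A]] show ?thesis
      by (simp add: matrix_exp_def)
  qed
  ultimately show "(\<lambda>n. matrix_power (mat 1 + (1 / real n) *\<^sub>R A) n $ i $ j)
      \<longlonglongrightarrow> matrix_exp A $ i $ j"
    by simp
qed

subsection \<open>Comparison of the chain with the lumped operators\<close>

lemma mem_lump: "x \<in> lump \<Lambda> x' \<longleftrightarrow> \<Lambda> x = x'"
  by (simp add: lump_def)

lemma lump_nonempty: "lumping_map \<Lambda> \<Longrightarrow> lump \<Lambda> x' \<noteq> {}"
  by (auto simp: lump_def lumping_map_def dest: surjD[of _ x'])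

text \<open>The lumps partition the state space. With \<open>p\<close> a row of \<open>Q\<close>
  this rewrites the lower rate operator, with \<open>p\<close> a distribution the lumped
  expectation, and with \<open>g\<close> equal to 1 the total mass.\<close>

lemma sum_over_lumps:
  fixes g :: "'y::finite \<Rightarrow> real" and p :: "'x::finite \<Rightarrow> real"
  shows "(\<Sum>y'\<in>UNIV. g y' * (\<Sum>y\<in>lump \<Lambda> y'. p y)) = (\<Sum>y\<in>UNIV. p y * g (\<Lambda> y))"
proof -
  have "(\<Sum>y\<in>UNIV. p y * g (\<Lambda> y)) = (\<Sum>y'\<in>UNIV. \<Sum>y\<in>{y \<in> UNIV. \<Lambda> y = y'}. p y * g (\<Lambda> y))"
    by (rule sum.group[symmetric]) auto
  then show ?thesis
    by (simp add: lump_def sum_distrib_left mult.commute)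
qed

definition unlump :: "('x::finite \<Rightarrow> 'y::finite) \<Rightarrow> real ^ 'y \<Rightarrow> real ^ 'x" where
  "unlump \<Lambda> g = (\<chi> x. g $ \<Lambda> x)"

lemma unlump_nth [simp]: "unlump \<Lambda> g $ x = g $ \<Lambda> x"
  by (simp add: unlump_def)

text \<open>Lumping distributions is adjoint to pulling functions back, which moves the claim to the
  original state space.\<close>

lemma lumped_distribution_inner: "lumped_distribution \<Lambda> p \<bullet> g = p \<bullet> unlump \<Lambda> g"
  using sum_over_lumps[of "\<lambda>y. g $ y" "\<lambda>x. p $ x" \<Lambda>]
  by (simp add: inner_vec_def lumped_distribution_def mult.commute)

lemma lower_rate_operator_nth:
  "lower_rate_operator \<Lambda> Q g $ x' = Min ((\<lambda>x. (Q *v unlump \<Lambda> g) $ x) ` lump \<Lambda> x')"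
  by (simp add: lower_rate_operator_def sum_over_lumps matrix_vector_mult_def)

lemma lower_rate_operator_le: "lower_rate_operator \<Lambda> Q g $ \<Lambda> x \<le> (Q *v unlump \<Lambda> g) $ x"
  unfolding lower_rate_operator_nth by (intro Min_le) (auto simp: mem_lump)

text \<open>A minimum of finitely many functions with a common Lipschitz constant has that constant
  too. Here the functions are the components of a bounded linear map.\<close>

lemma lower_rate_operator_lipschitz:
  fixes \<Lambda> :: "'x::finite \<Rightarrow> 'y::finite"
  assumes "lumping_map \<Lambda>"
  obtains L where "L-lipschitz_on UNIV (lower_rate_operator \<Lambda> Q)"
proof -
  have "linear (\<lambda>g. Q *v unlump \<Lambda> g)"
    by (auto intro!: linearI simp: vec_eq_iff matrix_vector_mult_def algebra_simps
        sum.distrib sum_distrib_left)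
  then have "bounded_linear (\<lambda>g. Q *v unlump \<Lambda> g)"
    by (simp add: linear_conv_bounded_linear)
  then obtain B where B: "0 \<le> B" "\<And>g. norm (Q *v unlump \<Lambda> g) \<le> norm g * B"
    using bounded_linear.nonneg_bounded by blast
  have one_sided: "lower_rate_operator \<Lambda> Q g $ x' - lower_rate_operator \<Lambda> Q h $ x' \<le> B * norm (g - h)"
    for g h x'
  proof -
    \<comment> \<open>A state \<open>x\<close> attaining the minimum for \<open>h\<close> is also a
      candidate in the minimum for \<open>g\<close>.\<close>
    have "lower_rate_operator \<Lambda> Q h $ x' \<in> (\<lambda>x. (Q *v unlump \<Lambda> h) $ x) ` lump \<Lambda> x'"
      unfolding lower_rate_operator_nth using lump_nonempty[OF assms] by (intro Min_in) auto
    then obtain x where x: "\<Lambda> x = x'" "lower_rate_operator \<Lambda> Q h $ x' = (Q *v unlump \<Lambda> h) $ x"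
      by (auto simp: mem_lump)
    have "lower_rate_operator \<Lambda> Q g $ x' - lower_rate_operator \<Lambda> Q h $ x'
        \<le> (Q *v unlump \<Lambda> g) $ x - (Q *v unlump \<Lambda> h) $ x"
      using lower_rate_operator_le[of \<Lambda> Q g x] x by simp
    also have "\<dots> = (Q *v unlump \<Lambda> (g - h)) $ x"
      by (simp add: matrix_vector_mult_def algebra_simps sum_subtractf)
    also have "\<dots> \<le> norm (Q *v unlump \<Lambda> (g - h))"
      using component_le_norm_cart abs_le_D1 by blast
    also have "\<dots> \<le> B * norm (g - h)"
      using B(2)[of "g - h"] by (simp add: mult.commute)
    finally show ?thesis .
  qed
  \<comment> \<open>The factor \<open>CARD('y)\<close> comes from bounding the norm by the sum of
    the absolute components.\<close>
  have "norm (lower_rate_operator \<Lambda> Q g - lower_rate_operator \<Lambda> Q h)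
      \<le> real CARD('y) * B * norm (g - h)" for g h
  proof -
    have "\<bar>(lower_rate_operator \<Lambda> Q g - lower_rate_operator \<Lambda> Q h) $ i\<bar> \<le> B * norm (g - h)" for i
      using one_sided[of g i h] one_sided[of h i g] by (simp add: norm_minus_commute)
    then have "(\<Sum>i\<in>UNIV. \<bar>(lower_rate_operator \<Lambda> Q g - lower_rate_operator \<Lambda> Q h) $ i\<bar>)
        \<le> real CARD('y) * (B * norm (g - h))"
      by (rule sum_bounded_above)
    then show ?thesis
      using norm_le_l1_cart[of "lower_rate_operator \<Lambda> Q g - lower_rate_operator \<Lambda> Q h"]
      by (simp add: mult.assoc)
  qed
  then have "(real CARD('y) * B)-lipschitz_on UNIV (lower_rate_operator \<Lambda> Q)"
    using B(1) by (intro lipschitz_onI) (auto simp: dist_norm)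
  then show ?thesis by (rule that)
qed

text \<open>The value of \<open>lim\<close> carries information only once convergence is known; the
  Lipschitz bound provides it.\<close>

lemma lower_transition_operator_tendsto:
  assumes "lumping_map \<Lambda>" "0 \<le> t"
  shows "(\<lambda>n. (euler_step (lower_rate_operator \<Lambda> Q) (t / real n) ^^ n) g)
           \<longlonglongrightarrow> lower_transition_operator \<Lambda> Q t g"
proof -
  obtain L where "L-lipschitz_on UNIV (lower_rate_operator \<Lambda> Q)"
    using assms(1) by (rule lower_rate_operator_lipschitz)
  from euler_convergent[OF this assms(2)] show ?thesis
    by (simp add: convergent_LIMSEQ_iff lower_transition_operator_def euler_step_def[abs_def])
qed

section \<open>The Euler scheme of the chain dominates the lumped one\<close>

lemma euler_step_matrix_iterate:
  "(euler_step (\<lambda>v. Q *v v) d ^^ n) f = matrix_power (mat 1 + d *\<^sub>R Q) n *v f"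
proof (induction n)
  case (Suc n)
  then show ?case
    by (simp add: euler_step_def matrix_vector_mul_assoc[symmetric] matrix_vector_mult_add_rdistrib
        scaleR_matrix_vector_assoc)
qed simp

lemma transition_matrix_tendsto:
  "(\<lambda>n. (euler_step (\<lambda>v. Q *v v) (t / real n) ^^ n) f) \<longlonglongrightarrow> transition_matrix Q t *v f"
proof -
  have "(\<lambda>n. matrix_power (mat 1 + (1 / real n) *\<^sub>R (t *\<^sub>R Q)) n *v f) \<longlonglongrightarrow> matrix_exp (t *\<^sub>R Q) *v f"
    unfolding matrix_vector_mult_def
    by (intro tendsto_intros matrix_power_tendsto_matrix_exp)
  then show ?thesis
    by (simp add: euler_step_matrix_iterate transition_matrix_def)
qed

text \<open>Splitting off the diagonal term shows two kinds of weights: the off-diagonal rates are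
  non-negative, and the diagonal weight is non-negative by the choice of \<open>d\<close>.\<close>

lemma euler_step_matrix_mono:
  assumes Q: "transition_rate_matrix Q" and d: "0 \<le> d" "\<And>x. 0 \<le> 1 + d * Q $ x $ x"
    and le: "\<And>x. v $ x \<le> w $ x"
  shows "euler_step ((*v) Q) d v $ x \<le> euler_step ((*v) Q) d w $ x"
proof -
  have split: "euler_step ((*v) Q) d u $ x
      = (1 + d * Q $ x $ x) * u $ x + d * (\<Sum>y\<in>UNIV - {x}. Q $ x $ y * u $ y)" for u
    by (simp add: euler_step_def matrix_vector_mult_def sum.remove[of UNIV x] algebra_simps)
  show ?thesis
    unfolding split using Q d le
    by (auto intro!: add_mono mult_left_mono sum_mono simp: transition_rate_matrix_def)
qed

text \<open>One lumped step lies below one step of \<open>Q\<close> from the same pulled-back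
  function; monotonicity of the latter then admits the induction hypothesis.\<close>

lemma lower_euler_iterate_le:
  assumes Q: "transition_rate_matrix Q" and d: "0 \<le> d" "\<And>x. 0 \<le> 1 + d * Q $ x $ x"
  shows "(euler_step (lower_rate_operator \<Lambda> Q) d ^^ n) g $ \<Lambda> x
           \<le> (euler_step ((*v) Q) d ^^ n) (unlump \<Lambda> g) $ x"
proof (induction n arbitrary: x)
  case (Suc n)
  define h where "h = (euler_step (lower_rate_operator \<Lambda> Q) d ^^ n) g"
  have "euler_step (lower_rate_operator \<Lambda> Q) d h $ \<Lambda> x \<le> euler_step ((*v) Q) d (unlump \<Lambda> h) $ x"
    using lower_rate_operator_le[of \<Lambda> Q h x] d(1) by (simp add: euler_step_def mult_left_mono)
  also have "\<dots> \<le> euler_step ((*v) Q) d ((euler_step ((*v) Q) d ^^ n) (unlump \<Lambda> g)) $ x"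
    using Suc unfolding h_def by (intro euler_step_matrix_mono[OF Q d]) auto
  finally show ?case by (simp add: h_def)
qed simp

lemma lower_transition_operator_le:
  assumes \<Lambda>: "lumping_map \<Lambda>" and Q: "transition_rate_matrix Q" and t: "0 \<le> t"
  shows "lower_transition_operator \<Lambda> Q t g $ \<Lambda> x \<le> (transition_matrix Q t *v unlump \<Lambda> g) $ x"
proof (rule tendsto_le)
  \<comment> \<open>The diagonal weight tends to 1. Finiteness of the state space then gives one
    threshold for all \<open>x\<close>.\<close>
  have "\<forall>\<^sub>F n in sequentially. 0 \<le> 1 + (t / real n) * Q $ x $ x" for x
  proof -
    have "(\<lambda>n. 1 + (t / real n) * Q $ x $ x) \<longlonglongrightarrow> 1 + 0 * Q $ x $ x"
      by (intro tendsto_intros lim_const_over_n)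
    from order_tendstoD(1)[OF this, of 0] show ?thesis
      by (auto elim: eventually_mono)
  qed
  then have "\<forall>\<^sub>F n in sequentially. \<forall>x. 0 \<le> 1 + (t / real n) * Q $ x $ x"
    by (rule eventually_all_finite)
  then show "\<forall>\<^sub>F n in sequentially.
      (euler_step (lower_rate_operator \<Lambda> Q) (t / real n) ^^ n) g $ \<Lambda> x
        \<le> (euler_step ((*v) Q) (t / real n) ^^ n) (unlump \<Lambda> g) $ x"
    by eventually_elim (use t in \<open>intro lower_euler_iterate_le[OF Q], auto\<close>)
qed (auto intro!: tendsto_vec_nth transition_matrix_tendsto lower_transition_operator_tendsto assms)

section \<open>The lumped initial distribution and the expectation\<close>

lemma positive_lumped_distribution:
  assumes "positive_distribution p" "lumping_map \<Lambda>"
  shows "positive_distribution (lumped_distribution \<Lambda> p)"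
proof -
  have "0 < (\<Sum>x\<in>lump \<Lambda> x'. p $ x)" for x'
    using assms(1) lump_nonempty[OF assms(2)]
    by (intro sum_pos) (auto simp: positive_distribution_def)
  moreover have "(\<Sum>x'\<in>UNIV. \<Sum>x\<in>lump \<Lambda> x'. p $ x) = (\<Sum>x\<in>UNIV. p $ x)"
    using sum_over_lumps[of "\<lambda>_. 1" "\<lambda>x. p $ x" \<Lambda>] by simp
  ultimately show ?thesis
    using assms(1)
    by (auto simp: positive_distribution_def distribution_def lumped_distribution_def less_imp_le)
qed

text \<open>The joint law of \<open>X 0\<close> and \<open>X t\<close> follows from the initial law
  and the transition probabilities from time 0; summing over both states gives the
  expectation.\<close>

lemma markov_chain_expectation:
  fixes X :: "real \<Rightarrow> 'w \<Rightarrow> 'x::finite"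
  assumes "markov_chain M X p Q" and t: "0 \<le> t"
  shows "prob_space.expectation M (\<lambda>\<omega>. f $ X t \<omega>) = p \<bullet> (transition_matrix Q t *v f)"
proof -
  interpret prob_space M
    using assms(1) by (simp add: markov_chain_def)
  have X [measurable]: "X s \<in> measurable M (count_space UNIV)" if "0 \<le> s" for s
    using assms(1) that by (simp add: markov_chain_def)
  note [measurable] = X[OF t] X[OF order_refl]
  have init: "\<P>(\<omega> in M. X 0 \<omega> = x) = p $ x" for x
    using assms(1) by (simp add: markov_chain_def)
  have joint: "\<P>(\<omega> in M. X t \<omega> = y \<and> X 0 \<omega> = x) = p $ x * transition_matrix Q t $ x $ y" for x y
  proof (cases "0 < p $ x")
    case True
    have "\<forall>s\<ge>0. \<forall>d\<ge>0. \<forall>x y. 0 < \<P>(\<omega> in M. X s \<omega> = x) \<longrightarrow>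
        \<P>(\<omega> in M. X (s + d) \<omega> = y \<bar> X s \<omega> = x) = transition_matrix Q d $ x $ y"
      using assms(1) unfolding markov_chain_def by (elim conjE)
    from this[rule_format, of 0 t x y]
    have "\<P>(\<omega> in M. X t \<omega> = y \<bar> X 0 \<omega> = x) = transition_matrix Q t $ x $ y"
      using True t by (simp add: init)
    then show ?thesis
      using True by (simp add: cond_prob_def init field_simps)
  \<comment> \<open>Here no conditional probability is prescribed, but \<open>p $ x\<close> is a
    probability, hence 0, and the joint probability is squeezed to 0.\<close>
  next
    case False
    then have "p $ x = 0"
      using init[of x] measure_nonneg by (metis order_le_less)
    moreover have "\<P>(\<omega> in M. X t \<omega> = y \<and> X 0 \<omega> = x) \<le> \<P>(\<omega> in M. X 0 \<omega> = x)"
      by (intro finite_measure_mono) auto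
    ultimately show ?thesis
      using init[of x] measure_nonneg by (simp add: order.antisym)
  qed
  define A where "A x y = {\<omega>\<in>space M. X t \<omega> = y \<and> X 0 \<omega> = x}" for x y
  have [measurable]: "A x y \<in> sets M" for x y
    unfolding A_def by measurable
  \<comment> \<open>On each event \<open>A x y\<close> the integrand is constant, so the expectation
    becomes a finite sum.\<close>
  have "expectation (\<lambda>\<omega>. f $ X t \<omega>)
      = expectation (\<lambda>\<omega>. \<Sum>x\<in>UNIV. \<Sum>y\<in>UNIV. f $ y * indicator (A x y) \<omega>)"
  proof (rule Bochner_Integration.integral_cong)
    fix \<omega> assume "\<omega> \<in> space M"
    then have "(\<Sum>x\<in>UNIV. \<Sum>y\<in>UNIV. f $ y * indicator (A x y) \<omega>)
        = (\<Sum>x\<in>UNIV. \<Sum>y\<in>UNIV. if X 0 \<omega> = x then if X t \<omega> = y then f $ y else 0 else 0)"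
      by (intro sum.cong) (auto simp: A_def indicator_def)
    also have "\<dots> = (\<Sum>x\<in>UNIV. if X 0 \<omega> = x then f $ X t \<omega> else 0)"
      by (intro sum.cong) auto
    finally show "f $ X t \<omega> =
        (\<Sum>x\<in>UNIV. \<Sum>y\<in>UNIV. f $ y * indicator (A x y) \<omega>)"
      by simp
  qed simp
  also have "\<dots> = (\<Sum>x\<in>UNIV. \<Sum>y\<in>UNIV. f $ y * prob (A x y))"
    by (simp add: Bochner_Integration.integral_sum Bochner_Integration.integrable_sum less_top[symmetric]
        del: Bochner_Integration.sum_mult_indicator)
  also have "\<dots> = p \<bullet> (transition_matrix Q t *v f)"
    by (simp add: A_def joint inner_vec_def matrix_vector_mult_def sum_distrib_left mult_ac)
  finally show ?thesis .
qed

theorem theorem1: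
  fixes M :: "'w measure"
    and X :: "real \<Rightarrow> 'w \<Rightarrow> 'x::finite"
    and \<pi>\<^sub>0 :: "real ^ 'x"
    and Q :: "real ^ 'x ^ 'x"
    and \<Lambda> :: "'x \<Rightarrow> 'y::finite"
    and f :: "real ^ 'x"
    and f' :: "real ^ 'y"
    and t :: real
  assumes "positive_irreducible_markov_chain M X \<pi>\<^sub>0 Q"
    and "lumping_map \<Lambda>"
    and "lumpable \<Lambda> f"
    and "\<forall>x. f $ x = f' $ \<Lambda> x"
    and "0 \<le> t"
  shows "positive_distribution (lumped_distribution \<Lambda> \<pi>\<^sub>0) \<and>
         lumped_distribution \<Lambda> \<pi>\<^sub>0 \<bullet> lower_transition_operator \<Lambda> Q t f'
           \<le> prob_space.expectation M (\<lambda>\<omega>. f $ X t \<omega>) \<and>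
         prob_space.expectation M (\<lambda>\<omega>. f $ X t \<omega>) = \<pi>\<^sub>0 \<bullet> (transition_matrix Q t *v f) \<and>
         \<pi>\<^sub>0 \<bullet> (transition_matrix Q t *v f)
           \<le> - (lumped_distribution \<Lambda> \<pi>\<^sub>0 \<bullet> lower_transition_operator \<Lambda> Q t (- f'))"
proof -
  have chain: "markov_chain M X \<pi>\<^sub>0 Q" and pos: "positive_distribution \<pi>\<^sub>0"
    using assms(1) by (auto simp: positive_irreducible_markov_chain_def)
  then have Q: "transition_rate_matrix Q"
    by (simp add: markov_chain_def)
  \<comment> \<open>The pointwise bound is averaged with the non-negative weights of the initial
    distribution. A general \<open>g\<close> serves both \<open>f'\<close> and
    \<open>- f'\<close>.\<close>
  have lower: "lumped_distribution \<Lambda> \<pi>\<^sub>0 \<bullet> lower_transition_operator \<Lambda> Q t g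
      \<le> \<pi>\<^sub>0 \<bullet> (transition_matrix Q t *v unlump \<Lambda> g)" for g
    unfolding lumped_distribution_inner unfolding inner_vec_def
    using lower_transition_operator_le[OF assms(2) Q assms(5)] pos
    by (auto intro!: sum_mono mult_left_mono simp: positive_distribution_def less_imp_le)
  have f: "unlump \<Lambda> f' = f" "unlump \<Lambda> (- f') = - f"
    using assms(4) by (simp_all add: vec_eq_iff)
  have neg: "transition_matrix Q t *v (- f) = - (transition_matrix Q t *v f)"
    by (simp add: vec_eq_iff matrix_vector_mult_def sum_negf)
  show ?thesis
    using positive_lumped_distribution[OF pos assms(2)] lower[of f'] lower[of "- f'"]
      markov_chain_expectation[OF chain assms(5), of f]
    by (simp add: f neg)
qed

end
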